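(* Let $p,q>0$. Every non-zero nilpotent element $X\in\mathfrak{sp}(p,q)$ is real, i.e. there exists $g\in\mathrm{Sp}(p,q)$ with $gXg^{-1}=-X$.
   Context: For a Lie group $G$ with Lie algebra $\mathfrak{g}$, $X\in\mathfrak{g}$ is real ($\mathrm{Ad}_G$-real) if $-X=\mathrm{Ad}(g)X$ for some $g\in G$. Let $\mathbb{H}$ be the real quaternions with usual conjugation $\overline{\,\cdot\,}$, and $\mathrm{I}_{p,q}=\mathrm{diag}(\mathrm{I}_p,-\mathrm{I}_q)$. $\mathrm{Sp}(p,q)=\{g\in\mathrm{SL}_{p+q}(\mathbb{H})\mid\overline{g}^t\mathrm{I}_{p,q}g=\mathrm{I}_{p,q}\}$, $\mathfrak{sp}(p,q)=\{z\in\mathfrak{sl}_{p+q}(\mathbb{H})\mid\overline{z}^t\mathrm{I}_{p,q}+\mathrm{I}_{p,q}z=0\}$, where $\mathrm{SL}_n(\mathbb{H})$ (resp. $\mathfrak{sl}_n(\mathbb{H})$) consists of the $n\times n$ quaternionic matrices of reduced norm $1$ (resp. reduced trace $0$). *)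

theory Defs
  imports "HOL-Analysis.Analysis"
begin

subsection \<open>Quaternions\<close>

text \<open>\<open>Quat a b c d\<close> stands for \<open>a + b i + c j + d k\<close>.\<close>

datatype quat = Quat (qre: real) (qi: real) (qj: real) (qk: real)

instantiation quat :: division_ring
begin

definition "0 = Quat 0 0 0 0"

definition "1 = Quat 1 0 0 0"

definition "x + y = Quat (qre x + qre y) (qi x + qi y) (qj x + qj y) (qk x + qk y)"

definition "x - y = Quat (qre x - qre y) (qi x - qi y) (qj x - qj y) (qk x - qk y)"

definition "- x = Quat (- qre x) (- qi x) (- qj x) (- qk x)"

definition "x * y = Quat
  (qre x * qre y - qi x * qi y - qj x * qj y - qk x * qk y)
  (qre x * qi y + qi x * qre y + qj x * qk y - qk x * qj y)
  (qre x * qj y - qi x * qk y + qj x * qre y + qk x * qi y)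
  (qre x * qk y + qi x * qj y - qj x * qi y + qk x * qre y)"

definition "inverse x =
  (let N = (qre x)\<^sup>2 + (qi x)\<^sup>2 + (qj x)\<^sup>2 + (qk x)\<^sup>2
   in Quat (qre x / N) (- qi x / N) (- qj x / N) (- qk x / N))"

definition "x div y = x * inverse (y :: quat)"

instance
proof
  fix x y z :: quat
  show "x + y + z = x + (y + z)" "x + y = y + x" "0 + x = x" "- x + x = 0" "x - y = x + - y"
    by (simp_all add: plus_quat_def minus_quat_def uminus_quat_def zero_quat_def)
  show "1 * x = x" "x * 1 = x"
    by (simp_all add: times_quat_def one_quat_def)
  show "(x * y) * z = x * (y * z)"
    by (simp add: times_quat_def algebra_simps)
  show "(x + y) * z = x * z + y * z" "x * (y + z) = x * y + x * z"
    by (simp_all add: times_quat_def plus_quat_def algebra_simps)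
  show "(0 :: quat) \<noteq> 1"
    by (simp add: zero_quat_def one_quat_def)
  show "x div y = x * inverse y"
    by (simp add: divide_quat_def)
  show "inverse (0 :: quat) = 0"
    by (simp add: inverse_quat_def zero_quat_def)
  assume "x \<noteq> 0"
  then have "(qre x)\<^sup>2 + (qi x)\<^sup>2 + (qj x)\<^sup>2 + (qk x)\<^sup>2 \<noteq> 0"
    by (cases x) (auto simp: zero_quat_def add_nonneg_eq_0_iff)
  then show "inverse x * x = 1" "x * inverse x = 1"
    by (simp_all add: inverse_quat_def times_quat_def one_quat_def Let_def
        power2_eq_square add_divide_distrib [symmetric] algebra_simps)
qed

end

definition qcnj :: "quat \<Rightarrow> quat" where
  "qcnj x = Quat (qre x) (- qi x) (- qj x) (- qk x)"

definition conj_transpose :: "quat^'n^'m \<Rightarrow> quat^'m^'n" where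
  "conj_transpose A = (\<chi> i j. qcnj (A $ j $ i))"


subsection \<open>Reduced norm and reduced trace\<close>

text \<open>Writing a quaternion as \<open>z + w j\<close> with complex \<open>z\<close>, \<open>w\<close>, a quaternionic matrix is
  \<open>Z + W j\<close> with complex matrices \<open>Z\<close>, \<open>W\<close>. The map sending it to the block matrix
  with rows \<open>(Z, W)\<close> and \<open>(- cnj W, cnj Z)\<close> is the usual splitting of the central simple
  real algebra of quaternionic \<open>n \<times> n\<close> matrices over the complex numbers. Reduced norm and
  reduced trace are the determinant and trace of the image; they are in fact real, but kept here
  as complex numbers.\<close>

definition quat_z :: "quat \<Rightarrow> complex" where
  "quat_z x = Complex (qre x) (qi x)"

definition quat_w :: "quat \<Rightarrow> complex" where
  "quat_w x = Complex (qj x) (qk x)"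

definition complexify :: "quat^'n^'n \<Rightarrow> complex^('n + 'n)^('n + 'n)" where
  "complexify A = (\<chi> r c. case (r, c) of
      (Inl i, Inl j) \<Rightarrow> quat_z (A $ i $ j)
    | (Inl i, Inr j) \<Rightarrow> quat_w (A $ i $ j)
    | (Inr i, Inl j) \<Rightarrow> - cnj (quat_w (A $ i $ j))
    | (Inr i, Inr j) \<Rightarrow> cnj (quat_z (A $ i $ j)))"

definition reduced_norm :: "quat^'n^'n \<Rightarrow> complex" where
  "reduced_norm A = det (complexify A)"

definition reduced_trace :: "quat^'n^'n \<Rightarrow> complex" where
  "reduced_trace A = trace (complexify A)"

lemma complexify_one: "complexify (mat 1 :: quat^'n^'n) = mat 1"
  by (auto simp: complexify_def mat_def vec_eq_iff quat_z_def quat_w_def one_quat_def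
      zero_quat_def complex_eq_iff split: sum.splits)

lemma complexify_mult:
  fixes A B :: "quat^'n^'n"
  shows "complexify (A ** B) = complexify A ** complexify B"
proof -
  have zw: "quat_z 0 = 0" "quat_w 0 = 0"
    "quat_z (x + y) = quat_z x + quat_z y" "quat_w (x + y) = quat_w x + quat_w y"
    "quat_z (x * y) = quat_z x * quat_z y - quat_w x * cnj (quat_w y)"
    "quat_w (x * y) = quat_z x * quat_w y + quat_w x * cnj (quat_z y)" for x y
    by (simp_all add: quat_z_def quat_w_def zero_quat_def plus_quat_def times_quat_def
        complex_eq_iff)
  have sum_z: "quat_z (\<Sum>k\<in>S. f k) = (\<Sum>k\<in>S. quat_z (f k))"
    and sum_w: "quat_w (\<Sum>k\<in>S. f k) = (\<Sum>k\<in>S. quat_w (f k))" for f and S :: "'n set"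
    by (induction S rule: infinite_finite_induct) (simp_all add: zw)
  have split: "(\<Sum>k\<in>UNIV. f k) = (\<Sum>k\<in>UNIV. f (Inl k)) + (\<Sum>k\<in>UNIV. f (Inr k))"
    for f :: "'n + 'n \<Rightarrow> complex"
    by (simp add: UNIV_Plus_UNIV [symmetric] sum.Plus del: UNIV_Plus_UNIV)
  show ?thesis
    by (auto simp: vec_eq_iff matrix_matrix_mult_def complexify_def split sum_z sum_w zw
        sum.distrib [symmetric] sum_negf [symmetric] sum_subtractf [symmetric]
        algebra_simps split: sum.splits intro!: sum.cong)
qed


subsection \<open>The group and the Lie algebra\<close>

text \<open>The index type \<open>'p + 'q\<close> has \<open>CARD('p)\<close> positive and \<open>CARD('q)\<close> negative
  directions; types being nonempty, both numbers are positive.\<close>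

definition SL :: "(quat^'n^'n) set" where
  "SL = {g. reduced_norm g = 1}"

definition sl_algebra :: "(quat^'n^'n) set" where
  "sl_algebra = {z. reduced_trace z = 0}"

definition I_pq :: "quat^('p::finite + 'q::finite)^('p + 'q)" where
  "I_pq = (\<chi> i j. if i = j then (case i of Inl _ \<Rightarrow> 1 | Inr _ \<Rightarrow> - 1) else 0)"

definition Sp_pq :: "(quat^('p::finite + 'q::finite)^('p + 'q)) set" where
  "Sp_pq = {g \<in> SL. conj_transpose g ** I_pq ** g = I_pq}"

definition sp_pq_algebra :: "(quat^('p::finite + 'q::finite)^('p + 'q)) set" where
  "sp_pq_algebra = {z \<in> sl_algebra. conj_transpose z ** I_pq + I_pq ** z = 0}"

definition nilpotent_matrix :: "'a::semiring_1^'n^'n \<Rightarrow> bool" where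
  "nilpotent_matrix A \<longleftrightarrow> (\<exists>k. (((**) A) ^^ k) (mat 1) = 0)"

definition Ad :: "'a::semiring_1^'n^'n \<Rightarrow> 'a^'n^'n \<Rightarrow> 'a^'n^'n" where
  "Ad g X = g ** X ** matrix_inv g"

definition Ad_real :: "('a::ring_1^'n^'n) set \<Rightarrow> 'a^'n^'n \<Rightarrow> bool" where
  "Ad_real G X \<longleftrightarrow> (\<exists>g\<in>G. - X = Ad g X)"

end

theory Submission
  imports Defs
begin

text \<open>Let \<open>h(u, w) = u\<^sup>* I\<^sub>p\<^sub>,\<^sub>q w\<close>. It suffices to find a skew-adjoint \<open>g\<close> with \<open>g\<^sup>2 = -1\<close> and
  \<open>g X = - X g\<close>: such a \<open>g\<close> preserves \<open>h\<close>, and its reduced norm is \<open>1\<close>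
  because \<open>(1 + g)\<^sup>2 = 2g\<close>. One splits off Jordan blocks orthogonally. If
  \<open>m\<close> is maximal with \<open>X\<^sup>m \<noteq> 0\<close>, there is \<open>v\<close> with \<open>a = h(v, X\<^sup>m v) \<noteq> 0\<close>, which can be modified so that
  \<open>h(v, X\<^sup>k v) = 0\<close> for \<open>k < m\<close>. On the nondegenerate span of the \<open>X\<^sup>k v\<close> put
  \<open>g(X\<^sup>k v) = \<plusminus>(-1)\<^sup>k X\<^sup>k v t\<close>, where \<open>t\<close> is a quaternion with \<open>t\<^sup>2 = -1\<close> that commutes or
  anticommutes with \<open>a\<close> according to the parity of \<open>m\<close>. The orthogonal decomposition is encoded by self-adjoint
  idempotents \<open>e\<close> commuting with \<open>X\<close>.\<close>

subsection \<open>Quaternions\<close>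

lemma qcnj_simps [simp]:
  "qcnj 0 = 0" "qcnj 1 = 1" "qcnj (x + y) = qcnj x + qcnj y" "qcnj (x - y) = qcnj x - qcnj y"
  "qcnj (- x) = - qcnj x" "qcnj (x * y) = qcnj y * qcnj x" "qcnj (qcnj x) = x"
  by (simp_all add: qcnj_def zero_quat_def one_quat_def plus_quat_def minus_quat_def
      uminus_quat_def times_quat_def algebra_simps)

lemma qcnj_sum: "qcnj (\<Sum>i\<in>S. f i) = (\<Sum>i\<in>S. qcnj (f i))"
  by (induction S rule: infinite_finite_induct) simp_all

lemma qcnj_inverse: "qcnj (inverse x) = inverse (qcnj x)"
  by (simp add: qcnj_def inverse_quat_def Let_def)

lemma minus_one_power_central: "(- 1) ^ k * x = x * (- 1) ^ k" for x :: "'a :: ring_1"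
  by (cases "even k") simp_all

lemma qcnj_minus_one_power [simp]: "qcnj ((- 1) ^ k) = (- 1) ^ k"
  by (cases "even k") simp_all

lemma real_quat_central:
  assumes "qcnj a = a"
  shows "a * x = x * a"
  using assms by (cases a; cases x) (simp add: qcnj_def times_quat_def)

text \<open>Here \<open>a\<close> is purely imaginary, and imaginary quaternions anticommute exactly
  when they are orthogonal as vectors in 3-space. So \<open>t\<close> is a unit vector orthogonal to
  \<open>(b, c, d)\<close>: \<open>(b, c)\<close> turned by a right angle and normalised, or
  \<open>i\<close> if \<open>b = c = 0\<close>.\<close>

lemma ex_anticommuting_unit:
  assumes "qcnj a = - a"
  shows "\<exists>t. t * t = - 1 \<and> qcnj t = - t \<and> t * a = - (a * t)"
proof -
  obtain b c d where a: "a = Quat 0 b c d"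
    using assms by (cases a) (auto simp: qcnj_def uminus_quat_def)
  show ?thesis
  proof (cases "b = 0 \<and> c = 0")
    case True
    then show ?thesis
      by (intro exI[of _ "Quat 0 1 0 0"])
        (simp add: a qcnj_def times_quat_def uminus_quat_def one_quat_def)
  next
    case False
    define r where "r = sqrt (b\<^sup>2 + c\<^sup>2)"
    have "r\<^sup>2 = b\<^sup>2 + c\<^sup>2" "r \<noteq> 0"
      using False by (auto simp: r_def add_nonneg_eq_0_iff)
    moreover have "(c / r) * (c / r) + (b / r) * (b / r) = (b\<^sup>2 + c\<^sup>2) / r\<^sup>2"
      by (simp add: power2_eq_square add_divide_distrib)
    ultimately have "(c / r) * (c / r) + (b / r) * (b / r) = 1"
      by (metis divide_self power_not_zero)
    then show ?thesis
      by (intro exI[of _ "Quat 0 (- c / r) (b / r) 0"])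
        (simp add: a qcnj_def times_quat_def uminus_quat_def one_quat_def algebra_simps)
  qed
qed

lemma ex_twisting_unit:
  assumes "qcnj a = (- 1) ^ m * a"
  shows "\<exists>t. t * t = - 1 \<and> qcnj t = - t \<and> t * a = (- 1) ^ m * a * t"
proof (cases "even m")
  case True
  then have "qcnj a = a"
    using assms by simp
  then have "Quat 0 1 0 0 * a = a * Quat 0 1 0 0"
    by (metis real_quat_central)
  moreover have "(- 1 :: quat) ^ m = 1"
    using True by simp
  ultimately show ?thesis
    by (intro exI[of _ "Quat 0 1 0 0"]) (simp, simp add: qcnj_def times_quat_def uminus_quat_def one_quat_def)
next
  case False
  then show ?thesis
    using assms ex_anticommuting_unit[of a] by simp
qed

text \<open>If \<open>z\<close> were invertible, \<open>z * q\<close> would run through all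
  quaternions. Taking 1 forces the sign factor to be \<open>- 1\<close>, and then \<open>i\<close>
  would equal its own conjugate.\<close>

lemma skew_eq_0:
  fixes z :: quat
  assumes "\<And>q. z * q = - (\<epsilon> * qcnj (z * q))"
  shows "z = 0"
proof (rule ccontr)
  assume "z \<noteq> 0"
  then have *: "q = - (\<epsilon> * qcnj q)" for q
    using assms[of "inverse z * q"] by (simp add: mult.assoc [symmetric])
  have "\<epsilon> = - 1"
    using *[of 1] by (metis add.inverse_inverse mult.right_neutral qcnj_simps(2))
  with *[of "Quat 0 1 0 0"] show False
    by (simp add: qcnj_def uminus_quat_def times_quat_def one_quat_def)
qed

subsection \<open>Vectors over the quaternions\<close>

text \<open>Scalars act from the right, so that matrices acting from the left are linear over the
  noncommutative quaternions.\<close>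

definition rscale :: "quat^'n \<Rightarrow> quat \<Rightarrow> quat^'n" (infixl "\<odot>" 75) where
  "v \<odot> q = (\<chi> i. v $ i * q)"

lemma rscale_simps [simp]:
  "v \<odot> 0 = 0" "0 \<odot> q = 0" "v \<odot> 1 = v" "v \<odot> q \<odot> r = v \<odot> (q * r)" "v \<odot> (- q) = - (v \<odot> q)"
  "(- v) \<odot> q = - (v \<odot> q)"
  by (simp_all add: rscale_def vec_eq_iff mult.assoc)

lemma rscale_add: "(v + w) \<odot> q = v \<odot> q + w \<odot> q"
  by (simp_all add: rscale_def vec_eq_iff algebra_simps)

lemma matrix_vector_mult_rscale: "A *v (v \<odot> q) = (A *v v) \<odot> q"
  by (simp add: matrix_vector_mult_def rscale_def vec_eq_iff sum_distrib_right mult.assoc)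

lemma matrix_vector_mult_sum: "A *v (\<Sum>i\<in>S. v i) = (\<Sum>i\<in>S. A *v v i)" for A :: "quat^'n^'m"
  by (induction S rule: infinite_finite_induct) (simp_all add: matrix_vector_right_distrib)

lemma matrix_vector_mult_uminus:
  "A *v (- v) = - (A *v v)" "(- A) *v v = - (A *v v)" for A :: "quat^'n^'m"
  by (simp_all add: matrix_vector_mult_def vec_eq_iff sum_negf)

lemma matrix_eqI:
  fixes A B :: "quat^'n^'m"
  assumes "\<And>v. A *v v = B *v v"
  shows "A = B"
  using assms by (simp add: matrix_eq)

lemma matrix_mult_rdistrib: "(A + B) ** C = A ** C + B ** C" for A B :: "quat^'n^'m"
  by (rule matrix_eqI) (simp add: matrix_vector_mult_add_rdistrib flip: matrix_vector_mul_assoc)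

lemma matrix_mult_uminus:
  "(- A) ** B = - (A ** B)" "A ** (- B) = - (A ** B)" for A :: "quat^'n^'m"
  by (rule matrix_eqI, simp add: matrix_vector_mult_uminus flip: matrix_vector_mul_assoc)+

lemma matrix_mult_diff:
  "(A - B) ** C = A ** C - B ** C" "C' ** (A - B) = C' ** A - C' ** B" for A B :: "quat^'n^'m"
  using matrix_mult_rdistrib[of A "- B" C] matrix_add_ldistrib[of C' A "- B"]
  by (simp_all add: matrix_mult_uminus)

definition herm_dot :: "quat^'n \<Rightarrow> quat^'n \<Rightarrow> quat" where
  "herm_dot u w = (\<Sum>i\<in>UNIV. qcnj (u $ i) * w $ i)"

lemma herm_dot_conj_transpose: "herm_dot (A *v u) w = herm_dot u (conj_transpose A *v w)"
  unfolding herm_dot_def conj_transpose_def matrix_vector_mult_def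
  by (simp add: qcnj_sum sum_distrib_left sum_distrib_right mult.assoc) (rule sum.swap)

lemma herm_dot_cnj: "qcnj (herm_dot u w) = herm_dot w u"
  by (simp add: herm_dot_def qcnj_sum)

lemma herm_dot_eqI:
  assumes "\<And>u. herm_dot u w = herm_dot u w'"
  shows "w = w'"
proof -
  have "herm_dot (axis i 1) v = v $ i" for i and v :: "quat^'n"
  proof -
    have "qcnj (axis i 1 $ k) * v $ k = (if k = i then v $ k else 0)" for k
      by (simp add: axis_def)
    then show ?thesis
      by (simp add: herm_dot_def)
  qed
  then show ?thesis
    using assms by (metis vec_eq_iff)
qed

lemma herm_dot_linear:
  "herm_dot u (w + w') = herm_dot u w + herm_dot u w'"
  "herm_dot (u + u') w = herm_dot u w + herm_dot u' w"
  "herm_dot u (- w) = - herm_dot u w" "herm_dot (- u) w = - herm_dot u w"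
  "herm_dot u 0 = 0" "herm_dot 0 w = 0"
  "herm_dot u (w \<odot> q) = herm_dot u w * q" "herm_dot (u \<odot> q) w = qcnj q * herm_dot u w"
  by (simp_all add: herm_dot_def rscale_def sum.distrib sum_negf algebra_simps
      sum_distrib_left sum_distrib_right)

lemma sum_matrix_vector_mult: "(\<Sum>i\<in>S. A i) *v v = (\<Sum>i\<in>S. A i *v v)" for A :: "'i \<Rightarrow> quat^'n^'m"
  by (induction S rule: infinite_finite_induct) (simp_all add: matrix_vector_mult_add_rdistrib)

subsection \<open>The reduced norm\<close>

lemma det_cnj: "det (\<chi> i j. cnj (M $ i $ j)) = cnj (det M)"
  by (simp add: det_def)

lemma cnj_reduced_norm:
  fixes A :: "quat^'n^'n"
  shows "cnj (reduced_norm A) = reduced_norm A"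
proof -
  \<comment> \<open>\<open>S\<close> is the image under \<open>complexify\<close> of the scalar
    matrix \<open>j\<close>. It conjugates the image of \<open>A\<close> into its entrywise complex
    conjugate, so the determinant is real.\<close>
  define S :: "complex^('n + 'n)^('n + 'n)" where
    "S = (\<chi> r c. case (r, c) of (Inl i, Inr j) \<Rightarrow> if i = j then 1 else 0
      | (Inr i, Inl j) \<Rightarrow> if i = j then - 1 else 0 | _ \<Rightarrow> 0)"
  have split: "(\<Sum>k\<in>UNIV. f k) = (\<Sum>k\<in>UNIV. f (Inl k)) + (\<Sum>k\<in>UNIV. f (Inr k))"
    for f :: "'n + 'n \<Rightarrow> complex"
    by (simp add: UNIV_Plus_UNIV [symmetric] sum.Plus del: UNIV_Plus_UNIV)
  have S: "S $ Inl i $ Inl j = 0" "S $ Inl i $ Inr j = (if i = j then 1 else 0)"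
    "S $ Inr i $ Inl j = (if i = j then - 1 else 0)" "S $ Inr i $ Inr j = 0" for i j
    by (simp_all add: S_def)
  have "S ** (- S) = mat 1"
    by (simp add: vec_eq_iff matrix_matrix_mult_def split split_sum_all S mat_def
        if_distrib[of "\<lambda>x. x * _"] if_distrib[of "\<lambda>x. _ * x"] if_distrib[of uminus] cong: if_cong)
  then have "det S * det (- S) = 1"
    by (metis det_I det_mul)
  then have "det S \<noteq> 0"
    by auto
  have "S ** complexify A = (\<chi> i j. cnj (complexify A $ i $ j)) ** S"
    by (simp add: vec_eq_iff matrix_matrix_mult_def split split_sum_all S complexify_def
        if_distrib[of "\<lambda>x. x * _"] if_distrib[of "\<lambda>x. _ * x"] if_distrib[of uminus] cong: if_cong)
  then have "det S * reduced_norm A = cnj (reduced_norm A) * det S"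
    by (metis det_cnj det_mul reduced_norm_def)
  with \<open>det S \<noteq> 0\<close> show ?thesis
    by simp
qed

lemma reduced_norm_mult: "reduced_norm (A ** B) = reduced_norm A * reduced_norm B"
  by (simp add: reduced_norm_def complexify_mult det_mul)

lemma reduced_norm_one: "reduced_norm (mat 1) = 1"
  by (simp add: reduced_norm_def complexify_one)

lemma complexify_add: "complexify (A + B) = complexify A + complexify B"
  by (auto simp: complexify_def vec_eq_iff quat_z_def quat_w_def plus_quat_def complex_eq_iff
      split: sum.splits)

lemma reduced_norm_double: "reduced_norm (A + A :: quat^'n^'n) = 2 ^ CARD('n + 'n) * reduced_norm A"
proof -
  have "complexify (A + A) = (\<chi> i. 2 *s complexify A $ i)"
    by (simp add: complexify_add vec_eq_iff)
  then show ?thesis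
    by (simp only: reduced_norm_def det_rows_mul) simp
qed

text \<open>Both \<open>r\<close> and \<open>s\<close> are real. From the fourth power of
  \<open>g\<close> being 1 one gets \<open>r = 1\<close> or \<open>r = - 1\<close>; the square of
  \<open>1 + g\<close> being \<open>g + g\<close> makes a positive multiple of \<open>r\<close>
  equal to \<open>s * s\<close>, which excludes \<open>- 1\<close>.\<close>

lemma reduced_norm_square_root_minus_one:
  fixes g :: "quat^'n^'n"
  assumes "g ** g = - mat 1"
  shows "reduced_norm g = 1"
proof -
  define r where "r = Re (reduced_norm g)"
  define s where "s = Re (reduced_norm (mat 1 + g))"
  have r: "reduced_norm g = of_real r" and s: "reduced_norm (mat 1 + g) = of_real s"
    using cnj_reduced_norm[of g] cnj_reduced_norm[of "mat 1 + g"]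
    by (simp_all add: r_def s_def complex_eq_iff)
  \<comment> \<open>Passing to the fourth power avoids computing the reduced norm of
    \<open>- mat 1\<close>.\<close>
  have "(g ** g) ** (g ** g) = mat 1"
    by (simp add: assms matrix_mult_uminus)
  then have "(complex_of_real r) ^ 4 = 1"
    by (metis (no_types, lifting) mult.assoc numeral_eq_Suc power4_eq_xxxx r reduced_norm_mult reduced_norm_one)
  then have "r ^ 4 = 1"
    by (metis of_real_eq_1_iff of_real_power)
  then have "r ^ 2 = 1"
    using power2_eq_1_iff[of "r ^ 2"] zero_le_power2[of r] by (auto simp flip: power_mult)
  have "(mat 1 + g) ** (mat 1 + g) = g + g"
    by (simp add: matrix_add_ldistrib matrix_mult_rdistrib assms)
  then have "complex_of_real (s * s) = of_real (2 ^ CARD('n + 'n) * r)"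
    by (metis (no_types, lifting) of_real_mult of_real_numeral of_real_power r s
        reduced_norm_double reduced_norm_mult)
  then have "s * s = 2 ^ CARD('n + 'n) * r"
    by (simp only: of_real_eq_iff)
  then have "0 \<le> r"
    by (metis zero_le_mult_iff zero_le_square not_numeral_le_zero zero_less_power zero_less_numeral
        not_less)
  with \<open>r ^ 2 = 1\<close> have "r = 1"
    by (simp add: power2_eq_1_iff)
  then show ?thesis
    by (simp add: r)
qed

lemma complexify_inject: "complexify A = complexify B \<Longrightarrow> A = B"
proof -
  assume "complexify A = complexify B"
  then have "complexify A $ Inl i $ Inl j = complexify B $ Inl i $ Inl j"
    "complexify A $ Inl i $ Inr j = complexify B $ Inl i $ Inr j" for i j
    by simp_all
  then show "A = B"
    by (simp add: complexify_def quat_z_def quat_w_def vec_eq_iff quat.expand)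
qed

subsection \<open>Hermitian forms\<close>

locale hermitian_form =
  fixes J :: "quat^'n^'n"
  assumes hermitian: "conj_transpose J = J"
    and nondegenerate: "J *v w = 0 \<Longrightarrow> w = 0"
begin

definition h :: "quat^'n \<Rightarrow> quat^'n \<Rightarrow> quat" where
  "h u w = herm_dot u (J *v w)"

definition self_adjoint :: "quat^'n^'n \<Rightarrow> bool" where
  "self_adjoint A \<longleftrightarrow> (\<forall>u w. h (A *v u) w = h u (A *v w))"

definition skew_adjoint :: "quat^'n^'n \<Rightarrow> bool" where
  "skew_adjoint A \<longleftrightarrow> (\<forall>u w. h (A *v u) w = - h u (A *v w))"

lemma h_linear:
  "h u (w + w') = h u w + h u w'" "h (u + u') w = h u w + h u' w"
  "h u (- w) = - h u w" "h (- u) w = - h u w" "h u 0 = 0" "h 0 w = 0"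
  "h u (w \<odot> q) = h u w * q" "h (u \<odot> q) w = qcnj q * h u w"
  by (simp_all add: h_def herm_dot_linear matrix_vector_right_distrib matrix_vector_mult_uminus
      matrix_vector_mult_rscale)

lemma h_diff: "h u (w - w') = h u w - h u w'" "h (u - u') w = h u w - h u' w"
  unfolding diff_conv_add_uminus h_linear by simp_all

lemma h_sum: "h u (\<Sum>i\<in>S. w i) = (\<Sum>i\<in>S. h u (w i))" "h (\<Sum>i\<in>S. w i) u = (\<Sum>i\<in>S. h (w i) u)"
  by (induction S rule: infinite_finite_induct) (simp_all add: h_linear)

lemma h_cnj: "qcnj (h u w) = h w u"
  by (metis h_def hermitian herm_dot_cnj herm_dot_conj_transpose)

lemma h_eq_0:
  assumes "\<And>u. h u w = 0"
  shows "w = 0"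
  using assms herm_dot_eqI[of "J *v w" 0] nondegenerate by (simp add: h_def herm_dot_linear)

text \<open>The operator sending \<open>x\<close> to \<open>u\<close> times
  \<open>c * h w x\<close>. Since \<open>J\<close> is hermitian, the conjugated entries of
  \<open>J *v w\<close> are the row representing \<open>h w\<close>.\<close>

definition rank_one :: "quat^'n \<Rightarrow> quat \<Rightarrow> quat^'n \<Rightarrow> quat^'n^'n" where
  "rank_one u c w = (\<chi> i j. u $ i * c * qcnj ((J *v w) $ j))"

lemma rank_one_mult: "rank_one u c w *v x = u \<odot> (c * h w x)"
proof -
  have "h w x = herm_dot (J *v w) x"
    by (simp add: h_def herm_dot_conj_transpose hermitian)
  then show ?thesis
    by (simp add: rank_one_def matrix_vector_mult_def rscale_def vec_eq_iff herm_dot_def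
        sum_distrib_left mult.assoc)
qed

end

subsection \<open>Orthogonal Jordan blocks of a skew-adjoint operator\<close>

locale skew_operator = hermitian_form J for J :: "quat^'n^'n" +
  fixes X :: "quat^'n^'n"
  assumes skew: "skew_adjoint X"
begin

abbreviation Xp :: "nat \<Rightarrow> quat^'n \<Rightarrow> quat^'n" where
  "Xp k \<equiv> ((*v) X) ^^ k"

lemma Xp_add_arg: "Xp k (u + w) = Xp k u + Xp k w"
  by (induction k) (simp_all add: matrix_vector_right_distrib)

lemma Xp_rscale: "Xp k (u \<odot> q) = Xp k u \<odot> q"
  by (induction k) (simp_all add: matrix_vector_mult_rscale)

lemma Xp_0_arg [simp]: "Xp k 0 = 0"
  by (induction k) simp_all

lemma Xp_Xp: "Xp j (Xp k v) = Xp (j + k) v"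
  by (simp add: funpow_add)

lemma Xp_eq_0_mono: "Xp k v = 0 \<Longrightarrow> k \<le> l \<Longrightarrow> Xp l v = 0"
  by (metis Xp_0_arg Xp_Xp le_add_diff_inverse2)

lemma h_Xp: "h (Xp k u) w = (- 1) ^ k * h u (Xp k w)"
proof (induction k arbitrary: w)
  case (Suc k)
  have "h (Xp (Suc k) u) w = - h (Xp k u) (X *v w)"
    using skew by (simp add: skew_adjoint_def)
  then show ?case
    by (simp add: Suc funpow_swap1)
qed simp

text \<open>Hence these values are real for even \<open>k\<close> and purely imaginary for odd
  \<open>k\<close>, which is the hypothesis of \<open>ex_twisting_unit\<close>.\<close>

lemma qcnj_h_Xp: "qcnj (h v (Xp k v)) = (- 1) ^ k * h v (Xp k v)"
  by (simp add: h_cnj h_Xp)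

lemma Xp_commute:
  assumes "e ** X = X ** e"
  shows "e *v Xp k v = Xp k (e *v v)"
proof (induction k)
  case (Suc k)
  have "e *v Xp (Suc k) v = X *v (e *v Xp k v)"
    using assms by (simp add: matrix_vector_mul_assoc)
  then show ?case
    by (simp add: Suc)
qed simp

text \<open>The values \<open>h v (Xp k v)\<close> are killed one by one from
  \<open>k = m - 1\<close> downwards. Adding a multiple of \<open>Xp (Suc j) v\<close> to
  \<open>v\<close> changes the value at \<open>k\<close> only by values at indices
  \<open>k + Suc j\<close> and above, and those beyond \<open>m\<close> are zero.\<close>

lemma ex_orthogonal_chain:
  assumes e: "e ** X = X ** e"
    and v: "e *v v = v" "Xp (Suc m) v = 0" "h v (Xp m v) \<noteq> 0"
    and j: "j \<le> m"
  shows "\<exists>v. e *v v = v \<and> Xp (Suc m) v = 0 \<and> h v (Xp m v) \<noteq> 0 \<and>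
           (\<forall>k. m - j \<le> k \<and> k < m \<longrightarrow> h v (Xp k v) = 0)"
  using j
proof (induction j)
  case 0
  then show ?case
    using v by (intro exI[of _ v]) auto
next
  case (Suc j)
  then obtain v where v: "e *v v = v" "Xp (Suc m) v = 0" "h v (Xp m v) \<noteq> 0"
      "\<And>k. m - j \<le> k \<Longrightarrow> k < m \<Longrightarrow> h v (Xp k v) = 0"
    by auto
  define A where "A k = h v (Xp k v)" for k
  \<comment> \<open>\<open>n\<close> is the next index to treat: the values strictly between
    \<open>n\<close> and \<open>m\<close> already vanish.\<close>
  define n where "n = m - Suc j"
  define half where "half = Quat (1/2) 0 0 0"
  have half: "half + half = 1" "qcnj half = half" "half * x = x * half" for x
    by (auto simp: half_def plus_quat_def one_quat_def qcnj_def times_quat_def)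
  have nm: "n + Suc j = m" "m = n + Suc j"
    using Suc.prems by (auto simp: n_def)
  \<comment> \<open>\<open>A m * q\<close> is half of \<open>- A n\<close>, and its mirror image in \<open>h v' (Xp n v')\<close> is the other half.\<close>
  define q where "q = - (inverse (A m) * A n * half)"
  have A0: "A k = 0" if "k > m" for k
    using Xp_eq_0_mono[OF v(2), of k] that by (simp add: A_def h_linear)
  have cA: "qcnj (A k) = (- 1) ^ k * A k" for k
    by (simp add: A_def qcnj_h_Xp)
  define v' where "v' = v + Xp (Suc j) v \<odot> q"
  have A': "h v' (Xp k v') = A k + A (k + Suc j) * q + qcnj q * (- 1) ^ Suc j * A (k + Suc j)
      + qcnj q * (- 1) ^ Suc j * A (k + Suc j + Suc j) * q" for k
  proof -
    have "h v' (Xp k v') = h v (Xp k v) + h v (Xp (k + Suc j) v) * q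
        + qcnj q * h (Xp (Suc j) v) (Xp k v) + qcnj q * h (Xp (Suc j) v) (Xp (k + Suc j) v) * q"
      unfolding v'_def
      by (simp only: Xp_add_arg Xp_rscale h_linear Xp_Xp) (simp add: algebra_simps)
    moreover have "h (Xp (Suc j) v) (Xp i v) = (- 1) ^ Suc j * A (i + Suc j)" for i
      by (simp only: h_Xp Xp_Xp A_def add.commute[of i])
    ultimately show ?thesis
      by (simp only: A_def mult.assoc)
  qed
  have "e *v v' = v'"
    by (simp only: v'_def matrix_vector_right_distrib matrix_vector_mult_rscale Xp_commute[OF e] v(1))
  moreover have "Xp (Suc m) v' = 0"
  proof -
    have "Xp (Suc m + Suc j) v = 0"
      using v(2) by (rule Xp_eq_0_mono) simp
    then show ?thesis
      by (simp only: v'_def Xp_add_arg Xp_rscale Xp_Xp v(2)) simp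
  qed
  moreover have "h v' (Xp m v') = A m"
    by (simp add: A' A0)
  moreover have "h v' (Xp k v') = 0" if "m - Suc j \<le> k" "k < m" for k
  proof (cases "k = n")
    case True
    have "A m * q = - (A n * half)"
      using v(3) by (simp add: q_def A_def mult.assoc [symmetric])
    moreover have "qcnj q * (- 1) ^ Suc j * A m = - (A n * half)"
    proof -
      have iA: "qcnj (inverse (A m)) = (- 1) ^ m * inverse (A m)"
        by (simp add: qcnj_inverse cA) (cases "even m"; simp)
      have "qcnj q = - (half * ((- 1) ^ n * A n) * ((- 1) ^ m * inverse (A m)))"
        by (simp add: q_def iA cA half mult.assoc)
      also have "\<dots> * (- 1) ^ Suc j * A m
          = - (half * A n * (((- 1) ^ (n + m + Suc j)) * inverse (A m) * A m))"
        by (cases "even n"; cases "even m"; cases "even j"; simp add: mult.assoc)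
      \<comment> \<open>The exponent equals \<open>2 * m\<close>.\<close>
      also have "((- 1) ^ (n + m + Suc j) :: quat) = 1"
        using nm by (metis add.commute add.left_commute even_add power_minus1_even even_two_times_div_two)
      finally show ?thesis
        using v(3) by (simp add: A_def mult.assoc half)
    qed
    \<comment> \<open>The term quadratic in \<open>q\<close> drops out because its index
      \<open>m + Suc j\<close> exceeds \<open>m\<close>.\<close>
    moreover have "h v' (Xp k v') = A n + A m * q + qcnj q * (- 1) ^ Suc j * A m"
      by (simp only: True A' nm(1)) (simp add: A0)
    ultimately have "h v' (Xp k v') = A n - A n * half - A n * half"
      by simp
    also have "\<dots> = A n - A n * (half + half)"
      by (simp only: distrib_left diff_diff_add)
    finally show ?thesis
      by (simp add: half)
  next
    case False
    then have "A k = 0" "k + Suc j > m"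
      using that v(4)[of k] by (auto simp: A_def n_def)
    then show ?thesis
      by (simp add: A' A0)
  qed
  ultimately show ?case
    using v(3) by (auto simp: A_def intro!: exI[of _ v'])
qed

text \<open>Let \<open>m\<close> be maximal with \<open>X\<close> to the power \<open>m\<close>
  nonzero on the range of \<open>e\<close>. If \<open>h v (N v)\<close> vanished for all
  \<open>v\<close>, polarisation would give a symmetry of \<open>h u (N w)\<close> that is
  incompatible with scaling \<open>w\<close> by quaternions, so \<open>N\<close> would be zero by
  nondegeneracy.\<close>

lemma ex_adapted_vector:
  assumes e: "e ** X = X ** e" "self_adjoint e" "e ** e = e" "e \<noteq> 0"
    and nilp: "\<And>w. Xp n w = 0"
  shows "\<exists>v m. e *v v = v \<and> Xp (Suc m) v = 0 \<and> h v (Xp m v) \<noteq> 0 \<and>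
           (\<forall>k<m. h v (Xp k v) = 0)"
proof -
  define d where "d = (LEAST d. \<forall>w. Xp d (e *v w) = 0)"
  have d: "Xp d (e *v w) = 0" for w
    using LeastI[of "\<lambda>d. \<forall>w. Xp d (e *v w) = 0" n] nilp by (simp add: d_def)
  have "d \<noteq> 0"
  proof
    assume "d = 0"
    then have "e = 0"
      using d by (intro matrix_eqI) simp
    with e(4) show False by simp
  qed
  then obtain m where m: "d = Suc m"
    using not0_implies_Suc by blast
  obtain w where w: "Xp m (e *v w) \<noteq> 0"
    using not_less_Least[of m "\<lambda>d. \<forall>w. Xp d (e *v w) = 0"] m by (auto simp: d_def)
  define N where "N w = Xp m (e *v w)" for w
  have ee: "e *v (e *v w) = e *v w" for w
    by (simp add: matrix_vector_mul_assoc e)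
  have he: "h (e *v u) w = h u (e *v w)" for u w
    using e(2) by (simp add: self_adjoint_def)
  have hN: "h w (N u) = (- 1) ^ m * qcnj (h u (N w))" for u w
  proof -
    have "qcnj (h u (N w)) = (- 1) ^ m * h w (e *v Xp m u)"
      unfolding N_def by (simp add: h_cnj h_Xp he)
    then show ?thesis
      by (simp add: N_def Xp_commute[OF e(1)] mult.assoc [symmetric] power_add [symmetric]
          flip: mult_2)
  qed
  have "\<exists>v. h v (N v) \<noteq> 0"
  proof (rule ccontr)
    assume "\<not> ?thesis"
    then have null: "h v (N v) = 0" for v
      by auto
    have N_add: "N (u + w) = N u + N w" and N_rscale: "N (u \<odot> q) = N u \<odot> q" for u w q
      by (simp_all add: N_def matrix_vector_right_distrib Xp_add_arg matrix_vector_mult_rscale Xp_rscale)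
    have "h u (N w) = - ((- 1) ^ m * qcnj (h u (N w)))" for u w
    proof -
      have "h u (N w) + h w (N u) = 0"
        using null[of "u + w"] null[of u] null[of w] by (simp add: N_add h_linear add.commute)
      then show ?thesis
        by (simp add: hN[of w u] eq_neg_iff_add_eq_0)
    qed
    \<comment> \<open>Every right multiple of the value \<open>h u (N w)\<close> satisfies the same
      skew identity, as \<open>skew_eq_0\<close> requires.\<close>
    from this[of u "w \<odot> q" for u q] have "h u (N w) = 0" for u
      by (intro skew_eq_0[of _ "(- 1) ^ m"]) (simp only: N_rscale h_linear)
    then have "N w = 0"
      by (rule h_eq_0)
    with w show False
      by (simp add: N_def)
  qed
  then obtain v where "h v (N v) \<noteq> 0" by blast
  then have "h (e *v v) (Xp m (e *v v)) \<noteq> 0"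
    by (simp add: he N_def Xp_commute[OF e(1)] ee)
  from ex_orthogonal_chain[OF e(1) ee _ this, of m] d[of v] m show ?thesis
    by fastforce
qed

text \<open>\<open>f\<close> is the orthogonal projection onto the span of the chain, and
  \<open>g\<close> the wanted structure on that span, extended by zero. Both belong to one family
  \<open>M i x\<close>, so one rule each for products, adjoints and commutation with
  \<open>X\<close> covers them.\<close>

lemma ex_chain_block:
  assumes e: "e ** X = X ** e" "self_adjoint e"
    and v: "e *v v = v" "Xp (Suc m) v = 0" "h v (Xp m v) \<noteq> 0" "\<And>k. k < m \<Longrightarrow> h v (Xp k v) = 0"
  shows "\<exists>f g. f \<noteq> 0 \<and> f ** f = f \<and> self_adjoint f \<and> f ** X = X ** f \<and> e ** f = f \<and> f ** e = f \<and>
    g ** g = - f \<and> f ** g = g \<and> g ** f = g \<and> skew_adjoint g \<and> g ** X = - (X ** g)"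
proof -
  define a where "a = h v (Xp m v)"
  have a: "a \<noteq> 0" "inverse a * a = 1" "a * inverse a = 1" "qcnj a = (- 1) ^ m * a"
    using v(3) by (simp_all add: a_def qcnj_h_Xp)
  have ia: "qcnj (inverse a) = (- 1) ^ m * inverse a"
    by (simp add: qcnj_inverse a) (cases "even m"; simp)
  \<comment> \<open>By \<open>gram\<close> below, \<open>M i x\<close> vanishes on the orthogonal complement of the chain and sends
    \<open>X\<^sup>l v\<close> to \<open>X\<^sup>l v\<close> times \<open>(-1)\<^bsup>i l + m - l\<^esup> x\<close>.\<close>
  define M where
    "M i x = (\<Sum>k\<le>m. rank_one (Xp k v) ((- 1) ^ (i * k) * x * inverse a) (Xp (m - k) v))"
    for i :: nat and x
  have M: "M i x *v y = (\<Sum>k\<le>m. Xp k v \<odot> ((- 1) ^ (i * k) * x * inverse a * h (Xp (m - k) v) y))"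
    for i x y
    by (simp add: M_def sum_matrix_vector_mult rank_one_mult)
  \<comment> \<open>Up to sign and the factor \<open>a\<close>, the reversed chain is dual to the
    chain. For \<open>k < l\<close> the total exponent exceeds \<open>m\<close> and the power kills
    \<open>v\<close>; for \<open>k > l\<close> it is below \<open>m\<close> and orthogonality
    applies.\<close>
  have gram: "h (Xp (m - k) v) (Xp l v) = (if k = l then (- 1) ^ (m - l) * a else 0)"
    if "k \<le> m" "l \<le> m" for k l
  proof -
    have "h (Xp (m - k) v) (Xp l v) = (- 1) ^ (m - k) * h v (Xp (m - k + l) v)"
      by (simp add: h_Xp Xp_Xp)
    moreover have "h v (Xp (m - k + l) v) = (if k = l then a else 0)"
    proof (cases k l rule: linorder_cases)
      case less
      then have "Xp (m - k + l) v = 0"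
        using that by (intro Xp_eq_0_mono[OF v(2)]) simp
      with less show ?thesis by (simp add: h_linear)
    next
      case greater
      then show ?thesis
        using v(4)[of "m - k + l"] that by simp
    qed (use that in \<open>simp add: a_def\<close>)
    ultimately show ?thesis by simp
  qed
  have M_basis: "M i x *v (Xp l v \<odot> q) = Xp l v \<odot> ((- 1) ^ (i * l) * x * ((- 1) ^ (m - l) * q))"
    if "l \<le> m" for i x l q
  proof -
    have "M i x *v (Xp l v \<odot> q) = (\<Sum>k\<le>m. if k = l
        then Xp l v \<odot> ((- 1) ^ (i * l) * x * inverse a * ((- 1) ^ (m - l) * a * q)) else 0)"
      unfolding M using that by (intro sum.cong) (auto simp: h_linear gram)
    also have "\<dots> = Xp l v \<odot> ((- 1) ^ (i * l) * x * inverse a * ((- 1) ^ (m - l) * a * q))"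
      using that by simp
    also have "(- 1) ^ (i * l) * x * inverse a * ((- 1) ^ (m - l) * a * q)
        = (- 1) ^ (i * l) * x * (inverse a * ((- 1) ^ (m - l) * a * q))"
      by (simp only: mult.assoc)
    also have "inverse a * ((- 1) ^ (m - l) * a * q) = (- 1) ^ (m - l) * q"
      by (cases "even (m - l)"; simp add: mult.assoc [symmetric] a)
    finally show ?thesis .
  qed
  \<comment> \<open>The sign \<open>(- 1) ^ (m - l)\<close> from \<open>M_basis\<close> splits into
    \<open>(- 1) ^ m\<close>, absorbed in the scalar, and \<open>(- 1) ^ l\<close>, which accounts
    for the \<open>+ 1\<close> in the first index.\<close>
  have M_M: "M i x ** M i' x' = M (i + i' + 1) ((- 1) ^ m * x * x')" for i i' x x'
  proof (rule matrix_eqI)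
    fix y
    have "(M i x ** M i' x') *v y = (\<Sum>l\<le>m. M i x *v
        (Xp l v \<odot> ((- 1) ^ (i' * l) * x' * inverse a * h (Xp (m - l) v) y)))"
      by (simp only: matrix_vector_mul_assoc [symmetric] M[of i'] matrix_vector_mult_sum)
    also have "\<dots> = (\<Sum>l\<le>m. Xp l v \<odot>
        ((- 1) ^ ((i + i' + 1) * l) * ((- 1) ^ m * x * x') * inverse a * h (Xp (m - l) v) y))"
    proof (intro sum.cong refl)
      fix l assume "l \<in> {..m}"
      then have "even (m - l) \<longleftrightarrow> (even m \<longleftrightarrow> even l)" "l \<le> m"
        by auto
      then have "(- 1) ^ (i * l) * x * ((- 1) ^ (m - l) * ((- 1) ^ (i' * l) * x'))
          = (- 1) ^ ((i + i' + 1) * l) * ((- 1) ^ m * x * x')"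
        by (cases "even i"; cases "even i'"; cases "even l"; cases "even m"; simp)
      then show "M i x *v (Xp l v \<odot> ((- 1) ^ (i' * l) * x' * inverse a * h (Xp (m - l) v) y))
        = Xp l v \<odot>
        ((- 1) ^ ((i + i' + 1) * l) * ((- 1) ^ m * x * x') * inverse a * h (Xp (m - l) v) y)"
        by (simp only: M_basis[OF \<open>l \<le> m\<close>] mult.assoc [symmetric])
    qed
    finally show "(M i x ** M i' x') *v y = M (i + i' + 1) ((- 1) ^ m * x * x') *v y"
      by (simp only: M)
  qed
  have M_cong: "M i x = M i' x" if "even i \<longleftrightarrow> even i'" for i i' x
  proof -
    have "(- 1 :: quat) ^ (i * k) = (- 1) ^ (i' * k)" for k
      using that by (cases "even i"; cases "even k"; simp)
    then show ?thesis
      by (simp add: M_def)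
  qed
  have M_minus: "M i (- x) = - M i x" for i x
    by (rule matrix_eqI) (simp add: M sum_negf matrix_vector_mult_uminus)
  have M_adjoint: "h (M i x *v u) w = h u (M i y *v w)"
    if "(- 1) ^ (i * m) * y * inverse a = (- 1) ^ m * inverse a * qcnj x" for i x y u w
  proof -
    have "h (M i x *v u) w = (\<Sum>k\<le>m. h u (Xp (m - k) v) *
        (((- 1) ^ m * inverse a * qcnj x) * (- 1) ^ (i * k)) * h (Xp k v) w)"
      by (simp add: M h_sum h_linear h_cnj ia mult.assoc)
    \<comment> \<open>Taking adjoints exchanges \<open>Xp k v\<close> and
      \<open>Xp (m - k) v\<close>; reversing the summation restores the shape of
      \<open>M\<close>.\<close>
    also have "\<dots> = (\<Sum>k\<le>m. h u (Xp k v) *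
        (((- 1) ^ m * inverse a * qcnj x) * (- 1) ^ (i * (m - k))) * h (Xp (m - k) v) w)"
      by (rule sum.reindex_bij_witness[of _ "\<lambda>k. m - k" "\<lambda>k. m - k"]) auto
    also have "\<dots> = (\<Sum>k\<le>m. h u (Xp k v \<odot> ((- 1) ^ (i * k) * y * inverse a * h (Xp (m - k) v) w)))"
    proof (intro sum.cong refl)
      fix k assume "k \<in> {..m}"
      then have "even (m - k) \<longleftrightarrow> (even m \<longleftrightarrow> even k)"
        by auto
      then have "(- 1) ^ (i * m) * y * inverse a * (- 1) ^ (i * (m - k)) = (- 1) ^ (i * k) * y * inverse a"
        by (cases "even i"; cases "even k"; cases "even m"; simp)
      then have eq: "(- 1) ^ m * inverse a * qcnj x * (- 1) ^ (i * (m - k)) = (- 1) ^ (i * k) * y * inverse a"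
        by (simp only: that)
      then show "h u (Xp k v) * (((- 1) ^ m * inverse a * qcnj x) * (- 1) ^ (i * (m - k))) * h (Xp (m - k) v) w
          = h u (Xp k v \<odot> ((- 1) ^ (i * k) * y * inverse a * h (Xp (m - k) v) w))"
        by (simp only: eq h_linear) (simp only: mult.assoc)
    qed
    finally show ?thesis
      by (simp add: M h_sum)
  qed
  \<comment> \<open>Both products are sums over \<open>k < m\<close>: on one side \<open>X\<close>
    kills the last chain vector, on the other the term \<open>k = 0\<close> contains
    \<open>Xp (Suc m) v\<close>. The sign combines the skewness of \<open>X\<close> with the index
    shift in \<open>(- 1) ^ (i * k)\<close>.\<close>
  have M_X: "M i x ** X = (if even i then - (X ** M i x) else X ** M i x)" for i x
  proof (rule matrix_eqI)
    fix y
    let ?F = "\<lambda>k. Xp (Suc k) v \<odot> ((- 1) ^ (i * k) * x * inverse a * h (Xp (m - k) v) y)"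
    have "X *v (M i x *v y) = (\<Sum>k\<le>m. ?F k)"
      by (simp add: M matrix_vector_mult_sum matrix_vector_mult_rscale)
    also have "\<dots> = (\<Sum>k<m. ?F k)"
      using v(2) by (simp only: lessThan_Suc_atMost [symmetric] sum.lessThan_Suc) simp
    finally have XM: "X *v (M i x *v y) = (\<Sum>k<m. ?F k)" .
    have "h (Xp k v) (X *v y) = - h (Xp (Suc k) v) y" for k
      using skew by (simp add: skew_adjoint_def)
    then have "M i x *v (X *v y) = (\<Sum>k<Suc m.
        - (Xp k v \<odot> ((- 1) ^ (i * k) * x * inverse a * h (Xp (Suc (m - k)) v) y)))"
      by (simp only: M lessThan_Suc_atMost mult_minus_right rscale_simps)
    also have "\<dots> = (\<Sum>k<m. - (Xp (Suc k) v \<odot>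
        ((- 1) ^ (i * Suc k) * x * inverse a * h (Xp (Suc (m - Suc k)) v) y)))"
      using v(2) by (simp only: sum.lessThan_Suc_shift diff_zero h_linear) simp
    also have "\<dots> = (\<Sum>k<m. if even i then - ?F k else ?F k)"
    proof (intro sum.cong refl)
      fix k assume "k \<in> {..<m}"
      then have "Suc (m - Suc k) = m - k"
        by auto
      moreover have "(- 1 :: quat) ^ (i * Suc k) = (if even i then (- 1) ^ (i * k) else - ((- 1) ^ (i * k)))"
        by (cases "even i"; cases "even k"; simp)
      ultimately show "- (Xp (Suc k) v \<odot>
          ((- 1) ^ (i * Suc k) * x * inverse a * h (Xp (Suc (m - Suc k)) v) y))
          = (if even i then - ?F k else ?F k)"
        by simp
    qed
    finally show "(M i x ** X) *v y = (if even i then - (X ** M i x) else X ** M i x) *v y"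
      by (simp add: matrix_vector_mul_assoc [symmetric] matrix_vector_mult_uminus XM sum_negf)
  qed
  have ef: "e ** M i x = M i x" "M i x ** e = M i x" for i x
  proof -
    have eXp: "e *v Xp k v = Xp k v" for k
      by (simp add: Xp_commute e v)
    show "e ** M i x = M i x"
      by (rule matrix_eqI)
        (simp add: M matrix_vector_mult_sum matrix_vector_mult_rscale eXp flip: matrix_vector_mul_assoc)
    have "h (Xp k v) (e *v y) = h (Xp k v) y" for k y
      using e(2) eXp by (metis self_adjoint_def)
    then show "M i x ** e = M i x"
      by (intro matrix_eqI) (simp add: M flip: matrix_vector_mul_assoc)
  qed
  obtain t where t: "t * t = - 1" "qcnj t = - t" "t * a = (- 1) ^ m * a * t"
    using ex_twisting_unit[OF a(4)] by blast
  have ta: "(- 1) ^ m * inverse a * t = t * inverse a"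
  proof -
    have "inverse a * t = inverse a * (t * a) * inverse a"
      by (simp only: mult.assoc a mult_1_right)
    also have "\<dots> = (- 1) ^ m * (inverse a * a * t * inverse a)"
      by (cases "even m"; simp add: t mult.assoc)
    finally have "inverse a * t = (- 1) ^ m * (t * inverse a)"
      by (simp only: a mult_1_left)
    then show ?thesis
      by (cases "even m"; simp)
  qed
  \<comment> \<open>On \<open>Xp l v\<close> the parameters of \<open>f\<close> give total sign
    \<open>(- 1) ^ (2 * m) = 1\<close>, hence the identity on the chain. Those of \<open>g\<close>
    give \<open>(- 1) ^ (m - l)\<close> times \<open>t\<close>; the even index 0 makes
    \<open>g\<close> anticommute with \<open>X\<close>.\<close>
  define f where "f = M 1 ((- 1) ^ m)"
  define g where "g = M 0 t"
  have pp: "(- 1) ^ m * (- 1) ^ m = (1 :: quat)"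
    by (cases "even m") auto
  have "f *v v = v"
    using M_basis[of 0 1 "(- 1) ^ m" 1] by (simp add: f_def pp)
  moreover have "v \<noteq> 0"
    using v(3) by (auto simp: h_linear)
  ultimately have "f \<noteq> 0"
    by auto
  moreover have "f ** f = f"
    unfolding f_def M_M by (simp add: pp) (rule M_cong, simp)
  moreover have "g ** g = - f"
    unfolding f_def g_def M_M by (simp add: t mult.assoc M_minus)
  moreover have "f ** g = g" "g ** f = g"
    unfolding f_def g_def M_M minus_one_power_central[of m t]
    by (simp_all add: pp mult.assoc) (auto intro!: M_cong)
  moreover have "self_adjoint f"
    unfolding self_adjoint_def f_def
    by (intro allI M_adjoint) (cases "even m"; simp)
  moreover have "skew_adjoint g"
    unfolding skew_adjoint_def
  proof (intro allI)
    fix u w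
    \<comment> \<open>The scalar condition of \<open>M_adjoint\<close> is here the relation
      \<open>ta\<close>; this is where the choice of \<open>t\<close> relative to \<open>a\<close>
      enters.\<close>
    have "h (g *v u) w = h u (M 0 (- t) *v w)"
      unfolding g_def by (rule M_adjoint) (simp add: t ta)
    then show "h (g *v u) w = - h u (g *v w)"
      by (simp add: M_minus g_def matrix_vector_mult_uminus h_linear)
  qed
  moreover have "f ** X = X ** f" "g ** X = - (X ** g)"
    by (simp_all add: f_def g_def M_X)
  ultimately show ?thesis
    using ef unfolding f_def g_def by blast
qed

text \<open>Induction on the complex dimension of the range of the complexified idempotent: split
  off one chain block \<open>f\<close>, treat \<open>e - f\<close> by induction, and add the two
  structures.\<close>

lemma ex_complex_structure:
  assumes nilp: "\<And>w. Xp n w = 0"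
    and "e ** X = X ** e" "self_adjoint e" "e ** e = e"
  shows "\<exists>g. g ** g = - e \<and> e ** g = g \<and> g ** e = g \<and> skew_adjoint g \<and> g ** X = - (X ** g)"
  using assms(2-)
proof (induction "vec.dim (range ((*v) (complexify e)))" arbitrary: e rule: less_induct)
  case less
  show ?case
  proof (cases "e = 0")
    case True
    then show ?thesis
      by (intro exI[of _ 0]) (simp add: skew_adjoint_def h_linear)
  next
    case False
    from ex_adapted_vector[OF less.prems False nilp] obtain v m where v: "e *v v = v"
        "Xp (Suc m) v = 0" "h v (Xp m v) \<noteq> 0" "\<forall>k<m. h v (Xp k v) = 0"
      by blast
    from ex_chain_block[OF less.prems(1,2) v(1-3) v(4)[rule_format]] obtain f g where
      f: "f \<noteq> 0" "f ** f = f" "self_adjoint f" "f ** X = X ** f"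
        "e ** f = f" "f ** e = f"
      and g: "g ** g = - f" "f ** g = g" "g ** f = g" "skew_adjoint g" "g ** X = - (X ** g)"
      by blast
    define e' where "e' = e - f"
    have e': "e' ** X = X ** e'" "self_adjoint e'" "e' ** e' = e'" "e ** e' = e'" "e' ** e = e'"
      "f ** e' = 0" "e' ** f = 0"
      using less.prems f by (simp_all add: e'_def matrix_mult_diff self_adjoint_def
          matrix_vector_mult_diff_rdistrib h_diff)
    let ?R = "\<lambda>A :: quat^'n^'n. range ((*v) (complexify A))"
    have sub: "vec.subspace (?R A)" for A
      by (intro vec.linear_subspace_image matrix_vector_mul_linear_gen vec.subspace_UNIV)
    have "?R e' \<subseteq> ?R e"
      by (metis complexify_mult e'(4) image_subsetI matrix_vector_mul_assoc rangeI)
    \<comment> \<open>An idempotent fixes its range, so equal ranges would give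
      \<open>e' ** e = e\<close>; but \<open>e' ** e = e'\<close>, and then
      \<open>f = 0\<close>.\<close>
    moreover have "?R e' \<noteq> ?R e"
    proof
      assume eq: "?R e' = ?R e"
      have "complexify e' *v (complexify e *v x) = complexify e *v x" for x
      proof -
        obtain y where "complexify e *v x = complexify e' *v y"
          using eq by (metis rangeE rangeI)
        then show ?thesis
          by (simp add: matrix_vector_mul_assoc e'(3) flip: complexify_mult)
      qed
      then have "complexify (e' ** e) = complexify e"
        by (simp add: matrix_eq complexify_mult matrix_vector_mul_assoc)
      then have "e' = e"
        using complexify_inject e'(5) by metis
      with f(1) show False
        by (simp add: e'_def)
    qed
    ultimately have "vec.dim (?R e') < vec.dim (?R e)"
      by (metis psubsetI sub vec.dim_psubset vec.span_eq_iff)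
    from less.hyps[OF this e'(1-3)] obtain g' where
      g': "g' ** g' = - e'" "e' ** g' = g'" "g' ** e' = g'" "skew_adjoint g'" "g' ** X = - (X ** g')"
      by blast
    \<comment> \<open>Insert \<open>f\<close> next to \<open>g\<close> and \<open>e'\<close> next to
      \<open>g'\<close>; these idempotents annihilate each other.\<close>
    have "g ** g' = 0" "g' ** g = 0"
      by (metis e'(6) g(3) g'(2) matrix_mul_assoc times0_left times0_right,
          metis e'(7) g(2) g'(3) matrix_mul_assoc times0_left times0_right)
    moreover have "e ** g = g" "g ** e = g" "e ** g' = g'" "g' ** e = g'"
      by (metis f(5) g(2) matrix_mul_assoc, metis f(6) g(3) matrix_mul_assoc,
          metis e'(4) g'(2) matrix_mul_assoc, metis e'(5) g'(3) matrix_mul_assoc)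
    ultimately show ?thesis
      using g g' by (intro exI[of _ "g + g'"])
        (simp add: matrix_mult_rdistrib matrix_add_ldistrib skew_adjoint_def h_linear
          matrix_vector_mult_add_rdistrib e'_def)
  qed
qed

end

subsection \<open>The signature form\<close>

lemma iterated_matrix_vector_mult:
  fixes A :: "'a::semiring_1^'n^'n"
  shows "((**) A ^^ k) (mat 1) *v w = ((*v) A ^^ k) w"
proof (induction k)
  case (Suc k)
  then show ?case
    by (simp flip: matrix_vector_mul_assoc)
qed simp

lemma conj_transpose_I_pq: "conj_transpose I_pq = I_pq"
  by (auto simp: conj_transpose_def I_pq_def vec_eq_iff split: sum.splits)

lemma I_pq_mult_I_pq: "I_pq ** I_pq = mat 1"
proof -
  have "(\<Sum>k\<in>UNIV. I_pq $ i $ k * I_pq $ k $ j) = (\<Sum>k\<in>UNIV. if k = i then I_pq $ i $ i * I_pq $ i $ j else 0)"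
    for i j :: "'a + 'b"
    by (rule sum.cong) (auto simp: I_pq_def)
  then show ?thesis
    by (simp add: vec_eq_iff matrix_matrix_mult_def mat_def) (auto simp: I_pq_def split: sum.splits)
qed

theorem corollary5p10:
  fixes X :: "quat^('p::finite + 'q::finite)^('p + 'q)"
  assumes "X \<in> sp_pq_algebra"
    and "X \<noteq> 0"
    and "nilpotent_matrix X"
  shows "Ad_real Sp_pq X"
proof -
  let ?J = "I_pq :: quat^('p + 'q)^('p + 'q)"
  interpret hermitian_form ?J
    by unfold_locales
      (metis conj_transpose_I_pq,
       metis I_pq_mult_I_pq matrix_vector_mul_assoc matrix_vector_mul_lid matrix_vector_mult_0_right)
  have h_left: "h (A *v u) w = herm_dot u ((conj_transpose A ** ?J) *v w)" for A u w
    by (simp add: h_def herm_dot_conj_transpose matrix_vector_mul_assoc)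
  have "conj_transpose X ** ?J = - (?J ** X)"
    using assms(1) by (simp add: sp_pq_algebra_def eq_neg_iff_add_eq_0)
  then have "skew_adjoint X"
    unfolding skew_adjoint_def h_left
    by (simp add: h_def matrix_vector_mult_uminus herm_dot_linear matrix_vector_mul_assoc)
  then interpret skew_operator ?J X
    by unfold_locales
  obtain n where "((**) X ^^ n) (mat 1) = 0"
    using assms(3) by (auto simp: nilpotent_matrix_def)
  then have "Xp n w = 0" for w
    by (metis iterated_matrix_vector_mult matrix_vector_mult_0)
  from ex_complex_structure[OF this, of "mat 1"]
  obtain g where g: "g ** g = - mat 1" "skew_adjoint g" "g ** X = - (X ** g)"
    by (auto simp: self_adjoint_def)
  have "conj_transpose g ** ?J ** g = ?J"
  proof (rule matrix_eqI, rule herm_dot_eqI)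
    fix u w
    have "herm_dot u ((conj_transpose g ** ?J ** g) *v w) = h (g *v u) (g *v w)"
      by (simp add: h_left matrix_vector_mul_assoc)
    also have "\<dots> = - h u ((g ** g) *v w)"
      using g(2) by (simp add: skew_adjoint_def matrix_vector_mul_assoc)
    also have "\<dots> = herm_dot u (?J *v w)"
      by (simp add: g(1) matrix_vector_mult_uminus h_linear) (simp add: h_def)
    finally show "herm_dot u ((conj_transpose g ** ?J ** g) *v w) = herm_dot u (?J *v w)" .
  qed
  then have "g \<in> Sp_pq"
    using reduced_norm_square_root_minus_one[OF g(1)] by (simp add: Sp_pq_def SL_def)
  moreover have "- X = Ad g X"
  proof -
    \<comment> \<open>\<open>matrix_inv\<close> is defined by choice, so a two-sided inverse has to
      be exhibited; it is \<open>- g\<close>.\<close>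
    have inv: "g ** (- g) = mat 1" "(- g) ** g = mat 1"
      by (simp_all add: matrix_mult_uminus g(1))
    then have "g ** matrix_inv g = mat 1"
      using someI_ex[of "\<lambda>B. g ** B = mat 1 \<and> B ** g = mat 1"] unfolding matrix_inv_def by blast
    then have "Ad g X = - (X ** mat 1)"
      by (simp add: Ad_def g(3) matrix_mult_uminus flip: matrix_mul_assoc)
    then show ?thesis by simp
  qed
  ultimately show ?thesis
    unfolding Ad_real_def by blast
qed

end
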